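(* For complex $u$ with $|u|<1$, \begin{multline*} - \operatorname{Li}_2 \left( \frac{2 u^2 - 3 u + \sqrt{ u (4-3u)}}{2 (u-1)^2} \right) - \operatorname{Li}_2 \left( \frac{2 u^2 - 3 u - \sqrt{ u (4-3u)}}{2 (u-1)^2} \right) \\ = \frac{3}{2} \ln^2 \left( 1 - \frac{u - \sqrt{(4 - 3 u) u}}{2 (u-1)} \right) - \operatorname{Li}_2 \left( \frac{u}{u - 1} \right). \end{multline*}
   Context: $\operatorname{Li}_2(x)=\sum_{n\ge1}x^n/n^2$ for $|x|\le1$, extended by analytic continuation (principal branch); $\ln$ and $\sqrt{\cdot}$ denote principal branches. *)

theory Defs
  imports "HOL-Complex_Analysis.Complex_Analysis"
begin

definition dilog_series :: "complex \<Rightarrow> complex" where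
  "dilog_series z = (\<Sum>n. z ^ Suc n / of_nat (Suc n) ^ 2)"

(*
  The series converges on the closed unit disc, including the branch point 1; the continuation
  is single-valued off the cut [1,\<infinity>).  On the open cut the usual convention is adopted that
  the principal branch is continuous from below (which matches the library's Ln, continuous
  from above on the negative axis, in Li2'(z) = - Ln (1 - z) / z).
*)
definition is_principal_dilog :: "(complex \<Rightarrow> complex) \<Rightarrow> bool" where
  "is_principal_dilog f \<longleftrightarrow>
     (\<forall>z. norm z \<le> 1 \<longrightarrow> f z = dilog_series z) \<and>
     f holomorphic_on (- (complex_of_real ` {1..})) \<and>
     (\<forall>x>1. (f \<longlongrightarrow> f (complex_of_real x)) (at (complex_of_real x) within {z. Im z < 0}))"

definition Li2 :: "complex \<Rightarrow> complex" where
  "Li2 = (THE f. is_principal_dilog f)"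

lemma dilog_series_bound:
  assumes "norm (z::complex) \<le> 1"
  shows "norm (z ^ Suc n / of_nat (Suc n) ^ 2) \<le> 1 / real (Suc n) ^ 2"
proof -
  have "norm z ^ Suc n \<le> 1"
    using assms by (intro power_le_one) auto
  thus ?thesis
    unfolding norm_divide norm_power norm_of_nat by (intro divide_right_mono) auto
qed

lemma summable_dilog_bound: "summable (\<lambda>n. 1 / real (Suc n) ^ 2)"
proof -
  have "summable (\<lambda>n. inverse (real n ^ 2))"
    by (rule inverse_power_summable) auto
  hence "summable (\<lambda>n. inverse (real (Suc n) ^ 2))"
    by (subst summable_Suc_iff)
  thus ?thesis by (simp add: divide_inverse)
qed

lemma dilog_series_sums:
  assumes "norm z \<le> 1"
  shows "(\<lambda>n. z ^ Suc n / of_nat (Suc n) ^ 2) sums dilog_series z"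
  unfolding dilog_series_def
  by (intro summable_sums summable_comparison_test'[OF summable_dilog_bound, of 0])
     (use dilog_series_bound[OF assms] in blast)

lemma continuous_on_dilog_series: "continuous_on (cball 0 1) dilog_series"
proof -
  have "uniform_limit (cball 0 1) (\<lambda>n z. \<Sum>i<n. z ^ Suc i / of_nat (Suc i) ^ 2)
          (\<lambda>z::complex. \<Sum>i. z ^ Suc i / of_nat (Suc i) ^ 2) sequentially"
    by (rule Weierstrass_m_test[OF _ summable_dilog_bound], rule dilog_series_bound) auto
  hence "continuous_on (cball 0 1) (\<lambda>z::complex. \<Sum>i. z ^ Suc i / of_nat (Suc i) ^ 2)"
    by (rule uniform_limit_theorem[rotated])
       (auto intro!: always_eventually continuous_intros simp del: power_Suc of_nat_Suc)
  thus ?thesis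
    unfolding dilog_series_def .
qed

lemma DERIV_dilog_series:
  assumes z: "norm z < 1"
  shows "(dilog_series has_field_derivative (if z = 0 then 1 else - Ln (1 - z) / z)) (at z)"
proof -
  define c :: "nat \<Rightarrow> complex" where "c = (\<lambda>n. 1 / of_nat n ^ 2)"
  have c0: "c 0 = 0" by (simp add: c_def)
  have sums: "(\<lambda>n. c n * w ^ n) sums dilog_series w" if "norm w \<le> 1" for w
  proof -
    have "(\<lambda>n. c (Suc n) * w ^ Suc n) sums dilog_series w"
      using dilog_series_sums[OF that] by (simp add: c_def del: power_Suc of_nat_Suc)
    thus ?thesis by (subst (asm) sums_Suc_iff) (simp add: c0)
  qed
  have eq: "dilog_series w = (\<Sum>n. c n * w ^ n)" if "norm w \<le> 1" for w
    using sums[OF that] by (simp add: sums_iff)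
  have diffs: "diffs c n = 1 / of_nat (Suc n)" for n
    by (simp add: diffs_def c_def power2_eq_square del: of_nat_Suc)
  have "summable (\<lambda>n. c n * 1 ^ n)"
    using sums[of 1] by (auto simp: sums_iff)
  hence "((\<lambda>w. \<Sum>n. c n * w ^ n) has_field_derivative (\<Sum>n. diffs c n * z ^ n)) (at z)"
    by (rule termdiffs_strong) (use z in auto)
  hence D: "(dilog_series has_field_derivative (\<Sum>n. diffs c n * z ^ n)) (at z)"
  proof (rule has_field_derivative_transform_within_open[where S = "ball 0 1"])
    show "(\<Sum>n. c n * w ^ n) = dilog_series w" if "w \<in> ball 0 1" for w
      using that by (subst eq) auto
  qed (use z in auto)
  have "(\<Sum>n. diffs c n * z ^ n) = (if z = 0 then 1 else - Ln (1 - z) / z)"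
  proof (cases "z = 0")
    case True
    thus ?thesis
      using powser_zero[of "diffs c"] by (simp add: diffs)
  next
    case False
    have "(\<lambda>n. - (z ^ n) / of_nat n) sums Ln (1 - z)"
      using Ln_series'[of "-z"] z by simp
    hence "(\<lambda>n. - (z ^ Suc n) / of_nat (Suc n)) sums Ln (1 - z)"
      by (subst sums_Suc_iff) simp
    from sums_mult[OF this, of "- 1 / z"]
    have "(\<lambda>n. diffs c n * z ^ n) sums (- Ln (1 - z) / z)"
      using False by (simp add: diffs del: of_nat_Suc)
    with False show ?thesis
      by (simp add: sums_iff)
  qed
  with D show ?thesis by simp
qed

lemma dilog_primitive:
  assumes "open S" "starlike S" "0 \<in> S" "L holomorphic_on S" "L 0 = 0"
  shows "\<exists>F. \<forall>z\<in>S. (F has_field_derivative (if z = 0 then deriv L 0 else L z / z)) (at z)"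
proof -
  have "(\<lambda>z. if z = 0 then deriv L 0 else (L z - L 0) / (z - 0)) holomorphic_on S"
    by (rule pole_lemma) (use assms in \<open>auto simp: interior_open\<close>)
  hence hol: "(\<lambda>z. if z = 0 then deriv L 0 else L z / z) holomorphic_on S"
    unfolding assms(5) diff_zero .
  show ?thesis
    by (rule holomorphic_starlike_primitive[where k = "{}"])
       (use assms hol in \<open>auto intro: holomorphic_on_imp_continuous_on
          simp: holomorphic_on_imp_differentiable_at\<close>)
qed

lemma open_dilog_domain: "open (- (complex_of_real ` {1..}))"
proof -
  have "complex_of_real ` {1..} = {z. Im z = 0 \<and> Re z \<ge> 1}"
    by (auto simp: complex_eq_iff image_iff)
  moreover have "closed {z. Im z = 0 \<and> Re z \<ge> 1}"
    by (intro closed_Collect_conj closed_Collect_eq closed_Collect_le continuous_intros)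
  ultimately show ?thesis by (simp add: open_Compl)
qed

lemma is_principal_dilog_unique:
  assumes f: "is_principal_dilog f" and g: "is_principal_dilog g"
  shows "f = g"
proof
  fix z :: complex
  have off: "f w = g w" if "w \<in> - (complex_of_real ` {1..})" for w
  proof (rule analytic_continuation_open[where s = "ball 0 1" and s' = "- (complex_of_real ` {1..})"
          and f = f and g = g and z = w])
    show "connected (- (complex_of_real ` {1..}))"
      by (intro starlike_imp_connected starlike_slotted_complex_plane_right)
    show "ball 0 1 \<subseteq> - (complex_of_real ` {1..})" by auto
  qed (use f g that open_dilog_domain in \<open>simp_all add: is_principal_dilog_def\<close>)
  show "f z = g z"
  proof (cases "norm z \<le> 1 \<or> z \<in> - (complex_of_real ` {1..})")
    case True
    thus ?thesis using f g off by (auto simp: is_principal_dilog_def)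
  next
    case False
    then obtain x where x: "z = of_real x" "x > 1" by auto
    have nt: "at z within {z. Im z < 0} \<noteq> bot"
    proof -
      have "closure {z. Im z < 0} = {z. Im z \<le> 0}"
        using closure_halfspace_lt[of \<i> 0] by (simp add: inner_complex_def)
      hence "z \<in> closure {z. Im z < 0}" "z \<notin> {z. Im z < 0}"
        using x by auto
      thus ?thesis by (simp add: at_within_eq_bot_iff)
    qed
    have lf: "(f \<longlongrightarrow> f z) (at z within {z. Im z < 0})"
      and lg: "(g \<longlongrightarrow> g z) (at z within {z. Im z < 0})"
      using f g x by (auto simp: is_principal_dilog_def)
    have "eventually (\<lambda>w. g w = f w) (at z within {z. Im z < 0})"
      unfolding eventually_at_filter by (rule always_eventually) (auto intro!: off[symmetric])
    with lg have "(f \<longlongrightarrow> g z) (at z within {z. Im z < 0})"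
      by (rule Lim_transform_eventually)
    with nt lf show ?thesis by (rule tendsto_unique)
  qed
qed

lemma is_principal_dilog_exists: "\<exists>f. is_principal_dilog f"
proof -
  define S where "S = - (complex_of_real ` {1..})"
  define L where "L = (\<lambda>z. - Ln (1 - z))"
  have S_iff: "z \<in> S \<longleftrightarrow> \<not> (Im z = 0 \<and> Re z \<ge> 1)" for z
    by (auto simp: S_def complex_eq_iff image_iff)
  have S: "open S" "starlike S" "0 \<in> S"
    unfolding S_def using open_dilog_domain starlike_slotted_complex_plane_right by auto
  have holL: "L holomorphic_on S"
    unfolding L_def by (intro holomorphic_intros) (auto simp: S_iff complex_nonpos_Reals_iff)
  have "(L has_field_derivative 1) (at 0)"
    unfolding L_def by (auto intro!: derivative_eq_intros simp: complex_nonpos_Reals_iff)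
  have L0: "L 0 = 0" by (simp add: L_def)
  from \<open>(L has_field_derivative 1) (at 0)\<close> have dL: "deriv L 0 = 1" by (rule DERIV_imp_deriv)
  obtain F0 where F0: "\<And>z. z \<in> S \<Longrightarrow>
      (F0 has_field_derivative (if z = 0 then 1 else L z / z)) (at z)"
    using dilog_primitive[OF S holL L0] unfolding dL by blast
  define F where "F = (\<lambda>z. F0 z - F0 0)"
  have F: "(F has_field_derivative (if z = 0 then 1 else L z / z)) (at z)" if "z \<in> S" for z
    unfolding F_def using F0[OF that] by (auto intro!: derivative_eq_intros split: if_splits)
  have contF: "continuous_on S F"
    by (intro DERIV_continuous_on[OF DERIV_subset[OF F]]) auto
  have ball_S: "z \<in> S" if "norm z < 1" for z
    using that complex_Re_le_cmod[of z] by (auto simp: S_iff)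
  have F_ball: "F z = dilog_series z" if z: "norm z < 1" for z
  proof -
    have "\<exists>c. \<forall>z\<in>ball 0 1. F z - dilog_series z = c"
    proof (rule has_field_derivative_zero_constant)
      fix w :: complex assume w: "w \<in> ball 0 1"
      hence "norm w < 1" by simp
      from DERIV_diff[OF F[OF ball_S[OF this]] DERIV_dilog_series[OF this]]
      show "((\<lambda>w. F w - dilog_series w) has_field_derivative 0) (at w within ball 0 1)"
        by (auto simp: L_def intro: has_field_derivative_at_within split: if_splits)
    qed auto
    then obtain c where c: "\<And>z. norm z < 1 \<Longrightarrow> F z - dilog_series z = c" by auto
    from c[of 0] have "c = 0" by (simp add: F_def dilog_series_def)
    with c[OF z] show ?thesis by simp
  qed
  have F_cball: "F z = dilog_series z" if z: "norm z \<le> 1" "z \<in> S" for z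
  proof -
    have seg: "of_real t * z \<in> S \<inter> cball 0 1" if "t \<in> {0..1}" for t :: real
    proof (cases "t = 1")
      case False
      have "norm (of_real t * z) \<le> \<bar>t\<bar>"
        using z by (simp add: norm_mult mult_left_le)
      also have "\<dots> < 1" using that False by auto
      finally show ?thesis using ball_S by auto
    qed (use z in auto)
    have "F (of_real 1 * z) - dilog_series (of_real 1 * z) = 0"
    proof (rule continuous_constant_on_closure[where S = "{0<..<1::real}" and x = 1
          and f = "\<lambda>t. F (of_real t * z) - dilog_series (of_real t * z)"])
      show "continuous_on (closure {0<..<1})
              (\<lambda>t::real. F (of_real t * z) - dilog_series (of_real t * z))"
        using seg
        by (intro continuous_intros continuous_on_compose2[OF contF]
              continuous_on_compose2[OF continuous_on_dilog_series]) auto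
      fix t :: real assume t: "t \<in> {0<..<1}"
      have "norm (of_real t * z) \<le> \<bar>t\<bar>"
        using z by (simp add: norm_mult mult_left_le)
      also have "\<dots> < 1" using t by auto
      finally show "F (of_real t * z) - dilog_series (of_real t * z) = 0"
        using F_ball by simp
    qed auto
    thus ?thesis by simp
  qed

  \<comment> \<open>The same primitive with the cut turned to 1 + i [0,\<infinity>), to continue F across (1,\<infinity>) from below.\<close>
  define S' where "S' = {z. Re z \<noteq> 1} \<union> {z. Im z < 0}"
  define L' where "L' = (\<lambda>z. - (Ln (\<i> * (z - 1)) + \<i> * pi / 2))"
  have S': "open S'" "0 \<in> S'"
    unfolding S'_def
    by (auto intro!: open_Un open_Collect_less open_Collect_neq continuous_intros)
  have star: "starlike S'"
    unfolding starlike_def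
  proof (rule bexI[of _ "1 - \<i>"], intro ballI subsetI)
    fix z w assume z: "z \<in> S'" and "w \<in> closed_segment (1 - \<i>) z"
    then obtain t where t: "0 \<le> t" "t \<le> 1" "w = (1 - t) *\<^sub>R (1 - \<i>) + t *\<^sub>R z"
      by (auto simp: closed_segment_def)
    have Re: "Re w - 1 = t * (Re z - 1)" and Im: "Im w = t * Im z - (1 - t)"
      by (simp_all add: t(3) algebra_simps)
    show "w \<in> S'"
    proof (cases "t = 0 \<or> Re z \<noteq> 1")
      case True
      thus ?thesis
        using Re Im by (cases "t = 0") (auto simp: S'_def)
    next
      case False
      hence "Im z < 0" "t > 0" using z t by (auto simp: S'_def)
      hence "t * Im z < 0" by (simp add: mult_pos_neg)
      hence "Im w < 0" using Im t by linarith
      thus ?thesis by (simp add: S'_def)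
    qed
  qed (auto simp: S'_def)
  have holL': "L' holomorphic_on S'"
    unfolding L'_def
    by (intro holomorphic_intros) (auto simp: S'_def complex_nonpos_Reals_iff)
  have L'0: "L' 0 = 0" by (simp add: L'_def)
  obtain H where H: "\<And>z. z \<in> S' \<Longrightarrow>
      (H has_field_derivative (if z = 0 then deriv L' 0 else L' z / z)) (at z)"
    using dilog_primitive[OF S'(1) star S'(2) holL' L'0] by blast
  have LL': "L' z = L z" if "Im z < 0" for z
  proof -
    have nz: "z - 1 \<noteq> 0" using that by auto
    have "Ln (\<i> * (z - 1)) = Ln (z - 1) + \<i> * pi / 2"
      using Ln_times_ii[OF nz] that by simp
    moreover have "Ln (1 - z) = Ln (z - 1) + \<i> * pi"
      using Ln_minus[OF nz] that by simp
    ultimately show ?thesis by (simp add: L_def L'_def field_simps)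
  qed
  have "\<exists>c. \<forall>z\<in>{z. Im z < 0}. F z - H z = c"
  proof (rule has_field_derivative_zero_constant)
    show "convex {z. Im z < 0}" by (rule convex_halfspace_Im_lt)
    fix w assume w: "w \<in> {z. Im z < 0}"
    hence "w \<in> S" "w \<in> S'" "w \<noteq> 0" by (auto simp: S_iff S'_def)
    with DERIV_diff[OF F[of w] H[of w]] LL'[of w] w
    have "((\<lambda>w. F w - H w) has_field_derivative 0) (at w)" by simp
    thus "((\<lambda>w. F w - H w) has_field_derivative 0) (at w within {z. Im z < 0})"
      by (rule has_field_derivative_at_within)
  qed
  then obtain c where c: "\<And>z. Im z < 0 \<Longrightarrow> F z = H z + c"
    by (auto simp: algebra_simps)

  define G where "G = (\<lambda>z. if norm z \<le> 1 then dilog_series z else if z \<in> S then F z else H z + c)"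
  have G_S: "G z = F z" if "z \<in> S" for z
    using that by (auto simp: G_def F_cball)
  have "is_principal_dilog G"
    unfolding is_principal_dilog_def S_def[symmetric]
  proof (intro conjI allI impI)
    have "F holomorphic_on S"
      using F S(1) by (auto simp: holomorphic_on_open)
    thus "G holomorphic_on S"
      by (rule holomorphic_transform) (simp add: G_S)
  next
    fix x :: real assume x: "x > 1"
    define z where "z = complex_of_real x"
    have z: "z \<in> S'" "z \<notin> S" "\<not> norm z \<le> 1"
      using x by (auto simp: z_def S'_def S_iff)
    have "isCont H z" using H[OF z(1)] by (rule DERIV_isCont)
    hence "((\<lambda>w. H w + c) \<longlongrightarrow> H z + c) (at z within {z. Im z < 0})"
      by (intro tendsto_intros) (auto simp: isCont_def intro: tendsto_within_subset)
    moreover have "eventually (\<lambda>w. H w + c = G w) (at z within {z. Im z < 0})"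
      unfolding eventually_at_filter
      by (rule always_eventually) (auto simp: G_S S_iff c)
    ultimately have "(G \<longlongrightarrow> H z + c) (at z within {z. Im z < 0})"
      by (rule Lim_transform_eventually)
    thus "(G \<longlongrightarrow> G (complex_of_real x)) (at (complex_of_real x) within {z. Im z < 0})"
      using z by (simp add: G_def z_def)
  qed (simp add: G_def)
  thus ?thesis by blast
qed

lemma is_principal_dilog_Li2: "is_principal_dilog Li2"
  unfolding Li2_def
  using is_principal_dilog_exists is_principal_dilog_unique by (metis theI)

end

theory Submission
  imports Defs
begin

text \<open>
  With \<open>w = 1 - (u - sqrt ((4 - 3u) u)) / (2 (u - 1))\<close> one has \<open>w + 1/w = 1 + 1/(1 - u)\<close>, and the
  three dilogarithm arguments become \<open>w - w\<^sup>2\<close>, \<open>1/w - 1/w\<^sup>2\<close> and \<open>2 - w - 1/w\<close>.  Put \<open>w = exp z\<close>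
  and \<open>q = w + 1/w - 1\<close>: one minus these arguments is \<open>w q\<close>, \<open>q / w\<close> and \<open>q\<close>.  Where \<open>w\<close> and \<open>q\<close>
  have positive real part, the principal logarithms of these three numbers are \<open>Ln q + z\<close>,
  \<open>Ln q - z\<close> and \<open>Ln q\<close>, so no branch cut is met and the identity follows by differentiation in \<open>z\<close>.
\<close>

lemma not_in_dilog_cut_iff: "z \<in> - (complex_of_real ` {1..}) \<longleftrightarrow> 1 - z \<notin> \<real>\<^sub>\<le>\<^sub>0"
  by (auto simp: complex_eq_iff image_iff complex_nonpos_Reals_iff)

text \<open>The power series gives this derivative on the unit disc, and the identity theorem
  carries it to the whole slit plane.\<close>

lemma has_field_derivative_Li2:
  assumes z: "1 - z \<notin> \<real>\<^sub>\<le>\<^sub>0"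
  shows "(Li2 has_field_derivative (if z = 0 then 1 else - Ln (1 - z) / z)) (at z)"
proof -
  define S where "S = - (complex_of_real ` {1..})"
  have S: "open S"
    unfolding S_def by (rule open_dilog_domain)
  have hol: "Li2 holomorphic_on S" and series: "\<And>w. norm w \<le> 1 \<Longrightarrow> Li2 w = dilog_series w"
    using is_principal_dilog_Li2 by (auto simp: is_principal_dilog_def S_def)
  have ball_D: "deriv Li2 w = (if w = 0 then 1 else - Ln (1 - w) / w)" if w: "norm w < 1" for w
  proof (rule DERIV_imp_deriv)
    show "(Li2 has_field_derivative (if w = 0 then 1 else - Ln (1 - w) / w)) (at w)"
      by (rule has_field_derivative_transform_within_open[OF DERIV_dilog_series[OF w],
            where S = "ball 0 1"])
         (use w series in auto)
  qed
  have zS: "z \<in> S"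
    using z unfolding S_def not_in_dilog_cut_iff .
  \<comment> \<open>Clearing the denominator leaves two functions that are visibly holomorphic at 0
    as well; the value of the derivative at 0 itself comes from \<open>ball_D\<close>.\<close>
  have eq: "z * deriv Li2 z = - Ln (1 - z)"
  proof (rule analytic_continuation_open[where s = "ball 0 1" and s' = S
          and f = "\<lambda>w. w * deriv Li2 w" and g = "\<lambda>w. - Ln (1 - w)"])
    show "connected S"
      unfolding S_def
      by (intro starlike_imp_connected starlike_slotted_complex_plane_right)
    show "ball 0 1 \<subseteq> S" unfolding S_def by auto
    show "(\<lambda>w. w * deriv Li2 w) holomorphic_on S"
      by (intro holomorphic_intros holomorphic_deriv hol S)
    show "(\<lambda>w. - Ln (1 - w)) holomorphic_on S"
      by (intro holomorphic_intros) (simp add: S_def not_in_dilog_cut_iff del: Compl_iff)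
    show "w * deriv Li2 w = - Ln (1 - w)" if "w \<in> ball 0 1" for w
      using that by (simp add: ball_D)
  qed (use S zS in auto)
  have "deriv Li2 z = (if z = 0 then 1 else - Ln (1 - z) / z)"
    using eq ball_D[of 0] by (auto simp: field_simps)
  with holomorphic_derivI[OF hol S zS] show ?thesis by simp
qed

text \<open>Both arguments lie strictly between -pi/2 and pi/2, so their sum stays strictly between
  -pi and pi: the logarithms add and the product misses the cut.\<close>

lemma Ln_times_Re_pos:
  assumes "0 < Re w" "0 < Re z"
  shows "Ln (w * z) = Ln w + Ln z" "w * z \<notin> \<real>\<^sub>\<le>\<^sub>0"
proof -
  have "\<bar>Im (Ln w)\<bar> < pi / 2" "\<bar>Im (Ln z)\<bar> < pi / 2" and nz: "w \<noteq> 0" "z \<noteq> 0"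
    using assms Re_Ln_pos_lt_imp by auto
  hence bd: "- pi < Im (Ln w) + Im (Ln z)" "Im (Ln w) + Im (Ln z) < pi"
    by linarith+
  show *: "Ln (w * z) = Ln w + Ln z"
    by (rule Ln_times_simple) (use bd nz in auto)
  have Im_pi: "Im (Ln y) = pi" if "y \<in> \<real>\<^sub>\<le>\<^sub>0" "y \<noteq> 0" for y
    using that by (auto simp: Im_Ln_eq_pi complex_nonpos_Reals_iff complex_eq_iff)
  show "w * z \<notin> \<real>\<^sub>\<le>\<^sub>0"
  proof
    assume "w * z \<in> \<real>\<^sub>\<le>\<^sub>0"
    hence "Im (Ln (w * z)) = pi"
      using nz by (intro Im_pi) auto
    with * bd show False by simp
  qed
qed

text \<open>Right side minus left side of the identity in the coordinate z = Ln w, where the squared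
  logarithm becomes a polynomial.\<close>

definition Li2_defect :: "complex \<Rightarrow> complex" where
  "Li2_defect z = Li2 (exp z - exp z ^ 2) + Li2 (exp (- z) - exp (- z) ^ 2) + 3 / 2 * z ^ 2
     - Li2 (2 - exp z - exp (- z))"

lemma Li2_defect_0: "Li2_defect 0 = 0"
  using is_principal_dilog_Li2
  by (simp add: Li2_defect_def is_principal_dilog_def dilog_series_def)

text \<open>The bound on \<open>Im z\<close> puts exp z and exp (-z) in the right half-plane and
  makes z the principal logarithm of exp z; the second hypothesis puts q there too.\<close>

lemma DERIV_Li2_defect:
  assumes Im: "\<bar>Im z\<bar> < pi / 2" and Re: "1 < Re (exp z + exp (- z))"
  shows "(Li2_defect has_field_derivative 0) (at z)"
proof -
  define w v q where "w = exp z" and "v = exp (- z)" and "q = w + v - 1"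
  define D where "D = (\<lambda>z. if z = 0 then 1 else - Ln (1 - z) / z)"
  have wv: "w * v = 1" and nz: "w \<noteq> 0" "v \<noteq> 0"
    by (simp_all add: w_def v_def exp_minus)
  have v: "v = 1 / w" using wv nz by (simp add: field_simps)
  have "cos (Im z) > 0"
    using Im by (intro cos_gt_zero_pi) auto
  hence pos: "Re w > 0" "Re v > 0" "Re q > 0"
    using Re by (simp_all add: w_def v_def q_def Re_exp)
  have Ln: "Ln w = z" "Ln v = - z"
    using Im pi_gt_zero by (auto simp: w_def v_def)
  have factor: "1 - (w - w ^ 2) = w * q" "1 - (v - v ^ 2) = v * q" "1 - (2 - w - v) = q"
    using wv by (simp_all add: q_def algebra_simps power2_eq_square)
  have cut: "1 - (w - w ^ 2) \<notin> \<real>\<^sub>\<le>\<^sub>0" "1 - (v - v ^ 2) \<notin> \<real>\<^sub>\<le>\<^sub>0" "1 - (2 - w - v) \<notin> \<real>\<^sub>\<le>\<^sub>0"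
    unfolding factor using Ln_times_Re_pos(2)[of _ q] pos
    by (auto simp: complex_nonpos_Reals_iff)
  have chain: "((\<lambda>z. Li2 (g z)) has_field_derivative D (g z) * g') (at z)"
    if "1 - g z \<notin> \<real>\<^sub>\<le>\<^sub>0" "(g has_field_derivative g') (at z)" for g g'
    using DERIV_chain2[OF has_field_derivative_Li2[OF that(1)] that(2)] by (simp add: D_def)
  have "((\<lambda>z. Li2 (exp z - exp z ^ 2)) has_field_derivative D (w - w ^ 2) * (w - 2 * w ^ 2)) (at z)"
    unfolding w_def
    by (rule chain)
       (use cut in \<open>auto simp: w_def power2_eq_square intro!: derivative_eq_intros\<close>)
  moreover have "((\<lambda>z. Li2 (exp (- z) - exp (- z) ^ 2)) has_field_derivative
      D (v - v ^ 2) * (2 * v ^ 2 - v)) (at z)"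
    unfolding v_def
    by (rule chain)
       (use cut in \<open>auto simp: v_def power2_eq_square intro!: derivative_eq_intros\<close>)
  moreover have "((\<lambda>z. Li2 (2 - exp z - exp (- z))) has_field_derivative
      D (2 - w - v) * (v - w)) (at z)"
    unfolding v_def w_def
    by (rule chain)
       (use cut in \<open>auto simp: v_def w_def intro!: derivative_eq_intros\<close>)
  moreover have "((\<lambda>z. 3 / 2 * z ^ 2) has_field_derivative 3 * z) (at z)"
    by (auto intro!: derivative_eq_intros)
  ultimately have "(Li2_defect has_field_derivative D (w - w ^ 2) * (w - 2 * w ^ 2)
      + D (v - v ^ 2) * (2 * v ^ 2 - v) + 3 * z - D (2 - w - v) * (v - w)) (at z)"
    unfolding Li2_defect_def[abs_def] by (intro DERIV_add DERIV_diff)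
  moreover have "D (w - w ^ 2) * (w - 2 * w ^ 2)
      + D (v - v ^ 2) * (2 * v ^ 2 - v) + 3 * z - D (2 - w - v) * (v - w) = 0"
  \<comment> \<open>Each of the three dilogarithm arguments vanishes exactly when w = 1; there z = 0
    and \<open>D\<close> takes its special value 1.\<close>
  proof (cases "w = 1")
    case True
    with v Ln show ?thesis by (simp add: D_def)
  next
    case False
    have vals: "w - w ^ 2 = w * (1 - w)" "v - v ^ 2 = - ((1 - w) / w ^ 2)"
        "2 - w - v = - ((1 - w) ^ 2 / w)"
      using nz by (simp_all add: v field_simps power2_eq_square)
    have "D (w - w ^ 2) = - (z + Ln q) / (w * (1 - w))"
         "D (v - v ^ 2) = - ((z - Ln q) * w ^ 2 / (1 - w))"
         "D (2 - w - v) = Ln q * w / (1 - w) ^ 2"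
      unfolding D_def factor using Ln_times_Re_pos(1)[of _ q] pos Ln False nz
      by (simp_all add: vals)
    \<comment> \<open>With Ln q replaced by a free l, the expression is linear in z and l, with
      coefficients rational in w; both coefficients cancel.\<close>
    moreover have "- (z + l) / (w * (1 - w)) * (w - 2 * w ^ 2)
        + - ((z - l) * w ^ 2 / (1 - w)) * (2 * v ^ 2 - v) + 3 * z - l * w / (1 - w) ^ 2 * (v - w) = 0"
      for l
    proof -
      have "- (z + l) / (w * (1 - w)) * (w - 2 * w ^ 2) = - (z + l) * (1 - 2 * w) / (1 - w)"
        using nz False by (simp add: divide_simps) (simp add: algebra_simps power2_eq_square)
      moreover have "- ((z - l) * w ^ 2 / (1 - w)) * (2 * v ^ 2 - v) = (l - z) * (2 - w) / (1 - w)"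
        using nz False by (simp add: v divide_simps) (simp add: algebra_simps power2_eq_square)
      moreover have "l * w / (1 - w) ^ 2 * (v - w) = l * (1 + w) / (1 - w)"
        using nz False by (simp add: v divide_simps) (simp add: algebra_simps power2_eq_square)
      moreover have "- (z + l) * (1 - 2 * w) / (1 - w) + (l - z) * (2 - w) / (1 - w) + 3 * z
          - l * (1 + w) / (1 - w) = 0"
        using False by (simp add: divide_simps) (simp add: algebra_simps)
      ultimately show ?thesis by simp
    qed
    ultimately show ?thesis by simp
  qed
  ultimately show ?thesis by simp
qed

text \<open>The defect is constant along the path from z vertically to Re z and then along the real
  axis to 0. The vertical piece stays in the region because cos (Im y) grows as y nears the
  axis.\<close>

lemma Li2_defect_eq_0:
  assumes Im: "\<bar>Im z\<bar> < pi / 2" and Re: "1 < Re (exp z + exp (- z))"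
  shows "Li2_defect z = 0"
proof -
  have const: "Li2_defect a = Li2_defect b"
    if "\<And>y. y \<in> closed_segment a b \<Longrightarrow> \<bar>Im y\<bar> < pi / 2 \<and> 1 < Re (exp y + exp (- y))" for a b
  proof -
    have "\<exists>c. \<forall>y\<in>closed_segment a b. Li2_defect y = c"
      by (rule has_field_derivative_zero_constant[OF convex_closed_segment
            has_field_derivative_at_within[OF DERIV_Li2_defect]])
         (use that in blast)+
    thus ?thesis using ends_in_segment by metis
  qed
  have Re_eq: "Re (exp y + exp (- y)) = (exp (Re y) + exp (- Re y)) * cos (Im y)" for y
    by (simp add: Re_exp algebra_simps)
  have "Li2_defect z = Li2_defect (of_real (Re z))"
  proof (rule const)
    fix y assume "y \<in> closed_segment z (of_real (Re z))"
    then obtain t where t: "0 \<le> t" "t \<le> 1" "y = (1 - t) *\<^sub>R z + t *\<^sub>R of_real (Re z)"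
      by (auto simp: closed_segment_def)
    have y: "Re y = Re z" "Im y = (1 - t) * Im z"
      by (simp_all add: t(3) algebra_simps)
    have le: "\<bar>Im y\<bar> \<le> \<bar>Im z\<bar>"
      using t by (simp add: y abs_mult mult_left_le_one_le)
    hence "cos \<bar>Im z\<bar> \<le> cos \<bar>Im y\<bar>"
      using Im pi_gt_zero by (intro cos_monotone_0_pi_le) auto
    hence "cos (Im z) \<le> cos (Im y)" by simp
    hence "Re (exp z + exp (- z)) \<le> Re (exp y + exp (- y))"
      unfolding Re_eq y(1) by (intro mult_left_mono add_nonneg_nonneg) auto
    with Re le Im show "\<bar>Im y\<bar> < pi / 2 \<and> 1 < Re (exp y + exp (- y))" by linarith
  qed
  also have "\<dots> = Li2_defect 0"
  proof (rule const)
    fix y assume "y \<in> closed_segment (complex_of_real (Re z)) 0"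
    hence "Im y = 0"
      by (auto simp: closed_segment_def)
    \<comment> \<open>The tangent-line bound at x and at -x gives a sum of at least 2.\<close>
    moreover have "1 < exp x + exp (- x)" for x :: real
      using exp_ge_add_one_self[of x] exp_ge_add_one_self[of "- x"] by linarith
    ultimately show "\<bar>Im y\<bar> < pi / 2 \<and> 1 < Re (exp y + exp (- y))"
      by (simp add: Re_exp)
  qed
  finally show ?thesis by (simp add: Li2_defect_0)
qed

theorem theorem5:
  fixes u :: complex
  assumes "norm u < 1"
  shows "- Li2 ((2 * u^2 - 3 * u + csqrt (u * (4 - 3 * u))) / (2 * (u - 1)^2))
         - Li2 ((2 * u^2 - 3 * u - csqrt (u * (4 - 3 * u))) / (2 * (u - 1)^2))
       = 3 / 2 * (Ln (1 - (u - csqrt ((4 - 3 * u) * u)) / (2 * (u - 1))))^2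
         - Li2 (u / (u - 1))"
proof -
  define s d where "s = csqrt (u * (4 - 3 * u))" and "d = u - 1"
  \<comment> \<open>The two signs of the square root give the two roots of X^2 - (1 + 1/(1 - u)) X +
    1, so v will turn out to be 1/w.\<close>
  define w v where "w = 1 - (u - s) / (2 * (u - 1))" and "v = 1 - (u + s) / (2 * (u - 1))"
  have s: "s ^ 2 = u * (4 - 3 * u)" by (simp add: s_def)
  have u1: "d \<noteq> 0" and Re_u: "Re (1 - u) > 0"
    using assms complex_Re_le_cmod[of u] by (auto simp: d_def)
  have u: "u = d + 1" by (simp add: d_def)
  have s': "s * s = (d + 1) * (1 - 3 * d)"
    using s by (simp add: u power2_eq_square algebra_simps)
  have wd: "2 * d * w = d - 1 + s" and vd: "2 * d * v = d - 1 - s"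
    using u1 by (simp_all add: w_def v_def u field_simps)
  have "4 * d ^ 2 * (w * v) = (d - 1 + s) * (d - 1 - s)"
    unfolding wd[symmetric] vd[symmetric] by (simp add: power2_eq_square)
  also have "\<dots> = 4 * d ^ 2"
    using s' by (simp add: algebra_simps power2_eq_square)
  finally have wv: "w * v = 1" using u1 by simp
  hence nz: "w \<noteq> 0" and v: "v = inverse w"
    by (auto intro: inverse_unique[symmetric])
  have sum: "w + v = 1 + inverse (1 - u)"
    using u1 by (simp add: w_def v_def u field_simps)
  have "(w - w ^ 2) * (2 * (u - 1) ^ 2) = (2 * d * w) * (2 * d - 2 * d * w) / 2"
    unfolding d_def[symmetric] by (simp add: algebra_simps power2_eq_square)
  also have "\<dots> = 2 * u ^ 2 - 3 * u + s"
    unfolding wd using s' by (simp add: field_simps power2_eq_square u)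
  finally have A: "(2 * u ^ 2 - 3 * u + s) / (2 * (u - 1) ^ 2) = w - w ^ 2"
    using u1 by (simp add: d_def nonzero_divide_eq_eq)
  have "(v - v ^ 2) * (2 * (u - 1) ^ 2) = (2 * d * v) * (2 * d - 2 * d * v) / 2"
    unfolding d_def[symmetric] by (simp add: algebra_simps power2_eq_square)
  also have "\<dots> = 2 * u ^ 2 - 3 * u - s"
    unfolding vd using s' by (simp add: field_simps power2_eq_square u)
  finally have B: "(2 * u ^ 2 - 3 * u - s) / (2 * (u - 1) ^ 2) = v - v ^ 2"
    using u1 by (simp add: d_def nonzero_divide_eq_eq)
  have C: "u / (u - 1) = 2 - w - v"
    using u1 by (simp add: w_def v_def u field_simps)
  have exp: "exp (Ln w) = w" "exp (- Ln w) = v"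
    using nz by (simp_all add: exp_minus v)
  \<comment> \<open>1/x is a positive multiple of the conjugate of x; at 0 both sides fail, as
    \<open>inverse 0 = 0\<close>.\<close>
  have inverse_pos: "Re (inverse x) > 0 \<longleftrightarrow> Re x > 0" for x :: complex
    by (cases "x = 0") (auto simp: zero_less_divide_iff complex_eq_iff sum_power2_gt_zero_iff
        not_sum_power2_lt_zero)
  have "Re (w + v) > 1"
    using inverse_pos[of "1 - u"] Re_u unfolding sum by simp
  \<comment> \<open>Re w and Re v have the same sign and their sum exceeds 1, so Re w is positive.
    Hence Ln w lies in the region where the defect vanishes.\<close>
  moreover from this have "Re w > 0"
    using inverse_pos[of w] by (cases "Re w > 0") (auto simp: v)
  ultimately have "Li2_defect (Ln w) = 0"
    using Re_Ln_pos_lt[OF nz] by (intro Li2_defect_eq_0) (auto simp: exp)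
  hence "- Li2 (w - w ^ 2) - Li2 (v - v ^ 2) = 3 / 2 * (Ln w) ^ 2 - Li2 (2 - w - v)"
    unfolding Li2_defect_def exp by (simp add: field_simps)
  thus ?thesis
    unfolding mult.commute[of "4 - 3 * u" u] s_def[symmetric] w_def[symmetric] A B C .
qed

end
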